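(* Let $(A,\cdot,[\cdot,\cdot])$ be a finite-dimensional transposed Poisson algebra over $\Bbbk$. Then $A$ is GD-solvable if and only if $A^{(1)}=A\cdot A+[A,A]$ is GD-nilpotent.
   Context: $\Bbbk$ is an algebraically closed field of characteristic $0$. A transposed Poisson algebra is a triple $(A,\cdot,[\cdot,\cdot])$ where $(A,\cdot)$ is a commutative associative algebra (not necessarily unital), $(A,[\cdot,\cdot])$ is a Lie algebra, and $2z\cdot[x,y]=[z\cdot x,y]+[x,z\cdot y]$ for all $x,y,z\in A$. (It is regarded as a Gelfand--Dorfman (GD) algebra with product $x\circ y=x\cdot y$.) $A$ is GD-solvable if $A^{(N)}=0$ for some $N\ge 0$, where $A^{(0)}=A$, $A^{(n+1)}=A^{(n)}\cdot A^{(n)}+[A^{(n)},A^{(n)}]$ (linear spans). An algebra $B$ with operations $\cdot,[\cdot,\cdot]$ (here $B=A^{(1)}$ with the induced operations) is GD-nilpotent if $B^{\langle N\rangle}=0$ for some $N\ge1$, where $B^{\langle1\rangle}=B$, $B^{\langle n+1\rangle}=\sum_{i=1}^n\bigl(B^{\langle i\rangle}\cdot B^{\langle n+1-i\rangle}+[B^{\langle i\rangle},B^{\langle n+1-i\rangle}]\bigr)$. *)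

theory Defs
  imports
    Complex_Main
    "HOL-Library.Set_Algebras"
    "HOL-Computational_Algebra.Polynomial"
begin

locale transposed_poisson_algebra = vector_space scale
  for scale :: "'k::field \<Rightarrow> 'a::ab_group_add \<Rightarrow> 'a" +
  fixes mul :: "'a \<Rightarrow> 'a \<Rightarrow> 'a"
    and brk :: "'a \<Rightarrow> 'a \<Rightarrow> 'a"
  assumes mul_linear_left: "Vector_Spaces.linear scale scale (\<lambda>x. mul x y)"
    and mul_linear_right: "Vector_Spaces.linear scale scale (\<lambda>y. mul x y)"
    and mul_commute: "mul x y = mul y x"
    and mul_assoc: "mul (mul x y) z = mul x (mul y z)"
    and brk_linear_left: "Vector_Spaces.linear scale scale (\<lambda>x. brk x y)"
    and brk_linear_right: "Vector_Spaces.linear scale scale (\<lambda>y. brk x y)"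
    and brk_alternating: "brk x x = 0"
    and brk_jacobi: "brk x (brk y z) + brk y (brk z x) + brk z (brk x y) = 0"
    and transposed_leibniz:
      "scale 2 (mul z (brk x y)) = brk (mul z x) y + brk x (mul z y)"

definition product_span ::
  "('k::field \<Rightarrow> 'a::ab_group_add \<Rightarrow> 'a) \<Rightarrow> ('a \<Rightarrow> 'a \<Rightarrow> 'a) \<Rightarrow> 'a set \<Rightarrow> 'a set \<Rightarrow> 'a set"
  where "product_span scale f U V = module.span scale {f u v |u v. u \<in> U \<and> v \<in> V}"

text \<open>
  Below, \<open>+\<close> and \<open>\<Sum>\<close> on sets are the elementwise (Minkowski) operations of
  \<^theory>\<open>HOL-Library.Set_Algebras\<close>; on subspaces they are sums of subspaces. The set \<open>B\<close> is the
  underlying subspace of a subalgebra, carrying the restrictions of \<open>mul\<close> and \<open>brk\<close>; the whole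
  algebra is \<open>B = UNIV\<close>.
\<close>

primrec gd_derived ::
  "('k::field \<Rightarrow> 'a::ab_group_add \<Rightarrow> 'a) \<Rightarrow> ('a \<Rightarrow> 'a \<Rightarrow> 'a) \<Rightarrow> ('a \<Rightarrow> 'a \<Rightarrow> 'a) \<Rightarrow>
    'a set \<Rightarrow> nat \<Rightarrow> 'a set"
  where
    "gd_derived scale mul brk B 0 = B"
  | "gd_derived scale mul brk B (Suc n) =
      product_span scale mul (gd_derived scale mul brk B n) (gd_derived scale mul brk B n)
      + product_span scale brk (gd_derived scale mul brk B n) (gd_derived scale mul brk B n)"

text \<open>The lower series is indexed from \<open>1\<close>; its value at \<open>0\<close> is a dummy.\<close>

fun gd_lower ::
  "('k::field \<Rightarrow> 'a::ab_group_add \<Rightarrow> 'a) \<Rightarrow> ('a \<Rightarrow> 'a \<Rightarrow> 'a) \<Rightarrow> ('a \<Rightarrow> 'a \<Rightarrow> 'a) \<Rightarrow>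
    'a set \<Rightarrow> nat \<Rightarrow> 'a set"
  where
    "gd_lower scale mul brk B 0 = B"
  | "gd_lower scale mul brk B (Suc 0) = B"
  | "gd_lower scale mul brk B (Suc (Suc n)) =
      (\<Sum>i\<in>{1..Suc n}.
        product_span scale mul
          (gd_lower scale mul brk B i) (gd_lower scale mul brk B (Suc (Suc n) - i))
        + product_span scale brk
          (gd_lower scale mul brk B i) (gd_lower scale mul brk B (Suc (Suc n) - i)))"

definition gd_solvable ::
  "('k::field \<Rightarrow> 'a::ab_group_add \<Rightarrow> 'a) \<Rightarrow> ('a \<Rightarrow> 'a \<Rightarrow> 'a) \<Rightarrow> ('a \<Rightarrow> 'a \<Rightarrow> 'a) \<Rightarrow> 'a set \<Rightarrow> bool"
  where "gd_solvable scale mul brk B \<longleftrightarrow> (\<exists>N. gd_derived scale mul brk B N = {0})"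

definition gd_nilpotent ::
  "('k::field \<Rightarrow> 'a::ab_group_add \<Rightarrow> 'a) \<Rightarrow> ('a \<Rightarrow> 'a \<Rightarrow> 'a) \<Rightarrow> ('a \<Rightarrow> 'a \<Rightarrow> 'a) \<Rightarrow> 'a set \<Rightarrow> bool"
  where "gd_nilpotent scale mul brk B \<longleftrightarrow> (\<exists>N\<ge>1. gd_lower scale mul brk B N = {0})"

end

theory Submission
  imports Defs
begin

text \<open>
  Write \<open>a\<^sub>x\<close> for the operator \<open>[x, -]\<close>, \<open>l\<^sub>z\<close> for multiplication by \<open>z\<close>, and \<open>B = A \<cdot> A + [A, A]\<close>.
  If \<open>B\<close> is nilpotent then it is solvable, since the derived series of \<open>B\<close> lies below its lower
  series; and the derived series of \<open>B\<close> is that of \<open>A\<close> shifted by one.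

  For the converse, take a chief factor of \<open>A\<close>: ideals \<open>J \<subset> I\<close>, stable under both operations, with
  no such ideal strictly between them. It suffices that \<open>B\<close> multiplies and brackets \<open>I\<close> into \<open>J\<close>
  (\<open>gd_derived_1_annihilates_chief\<close>). Indeed a product of two members of the lower series, of
  indices \<open>i\<close> and \<open>n - i\<close>, has one factor of index at least \<open>n / 2\<close>; so if the series is in \<open>I\<close>
  from index \<open>m\<close> on, it is in \<open>J\<close> from about \<open>2 * m\<close> on, and by descending dimension it reaches \<open>0\<close>.

  The transposed Leibniz rule makes \<open>[E, I]\<close> an ideal whenever \<open>E\<close> and \<open>I\<close> are. Hence, on a chief
  factor \<open>V = I / J\<close>, each ideal \<open>E\<close> satisfies \<open>[E, V] = 0\<close> or \<open>[E, V] = V\<close>, and the second is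
  impossible when \<open>E\<close> acts by commuting operators and is spanned by elements that act nilpotently
  (\<open>nilpotent_generators_in_centralizer\<close>). Nilpotent elements come from commutators: in
  characteristic \<open>0\<close> an operator \<open>[Y, X]\<close> that commutes with \<open>Y\<close> is nilpotent
  (\<open>commutator_nilpotent_mod\<close>). Going up the derived series of the solvable Lie algebra \<open>A\<close> from
  its last term, this shows that \<open>[A, A]\<close> acts as \<open>0\<close> on \<open>V\<close>, so the operators \<open>a\<^sub>x\<close> commute on \<open>V\<close>.

  By solvability all \<open>l\<^sub>z\<close> are nilpotent, and they commute. If the bracket with \<open>V\<close> is not zero, some
  \<open>w\<close> satisfies \<open>a\<^sub>w \<noteq> 0\<close> on \<open>V\<close> but \<open>a\<^sub>u = 0\<close> on \<open>V\<close> for every \<open>u \<in> A \<cdot> w\<close>. Then \<open>a\<^sub>w V\<close> is a nonzero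
  ideal, so \<open>a\<^sub>w\<close> is onto, and \<open>a\<^sub>w l\<^sub>z = 2 l\<^sub>z a\<^sub>w\<close>. The rule \<open>a\<^bsub>zx\<^esub> = 2 l\<^sub>z a\<^sub>x - a\<^sub>x l\<^sub>z\<close> now gives
  \<open>a\<^sub>w a\<^bsub>zx\<^esub> = 2 a\<^bsub>zx\<^esub> a\<^sub>w\<close>, while \<open>a\<^sub>w\<close> and \<open>a\<^bsub>zx\<^esub>\<close> commute; so \<open>a\<^bsub>zx\<^esub> a\<^sub>w = 0\<close> and \<open>A \<cdot> A\<close> acts as \<open>0\<close>
  (\<open>mul_in_centralizer_if_gd_solvable\<close>). Finally the common kernel of the \<open>l\<^sub>z\<close> on \<open>V\<close> is nonzero and
  is then stable under the bracket, so it is \<open>V\<close> (\<open>mul_chief_if_gd_solvable\<close>).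

  Quotients are avoided throughout: statements about \<open>I / J\<close> are written as congruences modulo \<open>J\<close>
  on \<open>I\<close>.
\<close>

section \<open>Commutators and polynomials of a linear operator\<close>

context finite_dimensional_vector_space
begin

definition poly_op :: "('b \<Rightarrow> 'b) \<Rightarrow> 'a poly \<Rightarrow> 'b \<Rightarrow> 'b"
  where "poly_op X p = fold_coeffs (\<lambda>a f v. scale a v + X (f v)) p (\<lambda>_. 0)"

context
  fixes X :: "'b \<Rightarrow> 'b"
  assumes X: "Vector_Spaces.linear scale scale X"
begin

lemma linear_op_simps:
  "X 0 = 0" "X (u + v) = X u + X v" "X (scale c v) = scale c (X v)"
  using X by (auto simp: linear_iff_module_hom module_hom.zero module_hom.add module_hom.scale)

lemma poly_op_0 [simp]: "poly_op X 0 v = 0"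
  by (simp add: poly_op_def)

lemma poly_op_pCons [simp]: "poly_op X (pCons a p) v = scale a v + X (poly_op X p v)"
  by (cases "a = 0 \<and> p = 0") (auto simp: poly_op_def linear_op_simps)

lemma poly_op_add [simp]: "poly_op X (p + q) v = poly_op X p v + poly_op X q v"
proof (induction p arbitrary: q)
  case (pCons a p)
  obtain b r where q: "q = pCons b r" by (cases q)
  have "poly_op X (pCons a p + q) v = scale (a + b) v + (X (poly_op X p v) + X (poly_op X r v))"
    by (simp add: q pCons.IH linear_op_simps)
  then show ?case by (simp add: q scale_left_distrib ac_simps)
qed simp

lemma poly_op_smult [simp]: "poly_op X (smult c p) v = scale c (poly_op X p v)"
  by (induction p) (simp_all add: linear_op_simps scale_right_distrib)

lemma poly_op_mult [simp]: "poly_op X (p * q) v = poly_op X p (poly_op X q v)"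
  by (induction p) (simp_all add: linear_op_simps scale_right_distrib)

lemma poly_op_diff [simp]: "poly_op X (p - q) v = poly_op X p v - poly_op X q v"
  using poly_op_add[of "p - q" q v] by simp

lemma poly_op_zero_vector [simp]: "poly_op X p 0 = 0"
  by (induction p) (simp_all add: linear_op_simps)

lemma poly_op_add_vector: "poly_op X p (u + v) = poly_op X p u + poly_op X p v"
  by (induction p) (simp_all add: linear_op_simps scale_right_distrib algebra_simps)

lemma poly_op_scale_vector: "poly_op X p (scale c v) = scale c (poly_op X p v)"
  by (induction p) (simp_all add: linear_op_simps scale_right_distrib mult.commute)

lemma poly_op_monom: "poly_op X (monom 1 n) v = (X ^^ n) v"
  by (induction n) (simp_all add: monom_0 monom_Suc one_pCons linear_op_simps)

text \<open>
  Otherwise no power \<open>X\<^sup>n v\<close> is a combination of the lower ones, and the vectors \<open>X\<^sup>k v\<close> form an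
  independent family larger than the dimension.
\<close>

lemma exists_poly_op_vector_eq_0: "\<exists>p. p \<noteq> 0 \<and> poly_op X p v = 0"
proof (rule ccontr)
  assume no: "\<not> ?thesis"
  have new: "(X ^^ n) v \<notin> span ((\<lambda>k. (X ^^ k) v) ` {..<n})" for n
  proof
    let ?R = "{poly_op X q v |q. \<forall>i\<ge>n. coeff q i = 0}"
    have "subspace ?R"
    proof (rule subspaceI)
      show "0 \<in> ?R" by (rule CollectI, rule exI[of _ 0]) simp
    next
      fix x y assume "x \<in> ?R" "y \<in> ?R"
      then obtain p q where "x = poly_op X p v" "y = poly_op X q v"
        "\<forall>i\<ge>n. coeff p i = 0" "\<forall>i\<ge>n. coeff q i = 0" by blast
      then show "x + y \<in> ?R" by (intro CollectI exI[of _ "p + q"]) simp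
    next
      fix c x assume "x \<in> ?R"
      then obtain p where "x = poly_op X p v" "\<forall>i\<ge>n. coeff p i = 0" by blast
      then show "scale c x \<in> ?R" by (intro CollectI exI[of _ "smult c p"]) simp
    qed
    moreover have "(\<lambda>k. (X ^^ k) v) ` {..<n} \<subseteq> ?R"
    proof (rule image_subsetI)
      fix k assume "k \<in> {..<n}"
      then show "(X ^^ k) v \<in> ?R"
        by (intro CollectI exI[of _ "monom 1 k"]) (simp add: poly_op_monom)
    qed
    ultimately have sub: "span ((\<lambda>k. (X ^^ k) v) ` {..<n}) \<subseteq> ?R"
      by (intro span_minimal)
    assume "(X ^^ n) v \<in> span ((\<lambda>k. (X ^^ k) v) ` {..<n})"
    then obtain q where q: "(X ^^ n) v = poly_op X q v" "\<forall>i\<ge>n. coeff q i = 0"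
      using sub by blast
    have "coeff (monom 1 n - q) n = 1" using q by simp
    then have "monom 1 n - q \<noteq> 0" by (metis coeff_0 zero_neq_one)
    moreover have "poly_op X (monom 1 n - q) v = 0"
      using q by (simp add: poly_op_monom)
    ultimately show False using no by blast
  qed
  have "independent ((\<lambda>k. (X ^^ k) v) ` {..<n}) \<and> card ((\<lambda>k. (X ^^ k) v) ` {..<n}) = n" for n
  proof (induction n)
    case (Suc n)
    have "(X ^^ n) v \<notin> (\<lambda>k. (X ^^ k) v) ` {..<n}"
      using new[of n] by (rule contrapos_nn) (rule span_base)
    moreover have "independent (insert ((X ^^ n) v) ((\<lambda>k. (X ^^ k) v) ` {..<n}))"
      by (rule independent_insertI[OF new conjunct1[OF Suc]])
    ultimately show ?case
      using Suc by (simp only: lessThan_Suc image_insert card_insert_disjoint finite_imageI finite_lessThan simp_thms)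
  qed (use independent_empty in simp)
  then have "n \<le> dim UNIV" for n
    using independent_card_le_dim[OF subset_UNIV, of "(\<lambda>k. (X ^^ k) v) ` {..<n}"] by metis
  from this[of "Suc (dim UNIV)"] show False by linarith
qed

text \<open>
  Polynomials in \<open>X\<close> commute, so the product of polynomials that kill the basis vectors one by one
  kills all of them.
\<close>

lemma exists_annihilating_poly: "\<exists>p. p \<noteq> 0 \<and> (\<forall>v. poly_op X p v = 0)"
proof -
  have "finite F \<Longrightarrow> \<exists>p. p \<noteq> 0 \<and> (\<forall>v\<in>F. poly_op X p v = 0)" for F
  proof (induction F rule: finite_induct)
    case empty
    show ?case by (rule exI[of _ 1]) simp
  next
    case (insert v F)
    then obtain p where p: "p \<noteq> 0" "\<forall>v\<in>F. poly_op X p v = 0" by blast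
    obtain q where q: "q \<noteq> 0" "poly_op X q v = 0" using exists_poly_op_vector_eq_0 by blast
    have "poly_op X (p * q) u = 0" if "u \<in> insert v F" for u
    proof (cases "u = v")
      case False
      with that p have "poly_op X (q * p) u = 0" by simp
      then show ?thesis by (simp only: mult.commute)
    qed (simp add: q)
    with p q show ?case by (intro exI[of _ "p * q"]) simp
  qed
  then obtain p where p: "p \<noteq> 0" "\<forall>v\<in>Basis. poly_op X p v = 0" using finite_Basis by blast
  have "subspace {v. poly_op X p v = 0}"
    by (rule subspaceI) (simp_all add: poly_op_add_vector poly_op_scale_vector)
  then have "span Basis \<subseteq> {v. poly_op X p v = 0}"
    using p by (intro span_minimal) auto
  with p show ?thesis by (auto simp: span_Basis)
qed

end

end

definition commutator :: "('b::ab_group_add \<Rightarrow> 'b) \<Rightarrow> ('b \<Rightarrow> 'b) \<Rightarrow> 'b \<Rightarrow> 'b"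
  where "commutator Y T v = Y (T v) - T (Y v)"

text \<open>
  The Kleinecke--Shirokov theorem for the operators that \<open>X\<close> and \<open>Y\<close> induce on \<open>I / J\<close>. Put
  \<open>D = [Y, -]\<close>, a derivation. As \<open>D X = W\<close> and \<open>D W = 0\<close>, the Leibniz rule gives
  \<open>D\<^sup>n (p(X)) = n! c W\<^sup>n\<close> for a polynomial \<open>p\<close> of degree at most \<open>n\<close> with \<open>n\<close>-th coefficient \<open>c\<close>.
  Apply this to the degree \<open>n\<close> of a nonzero polynomial with \<open>p(X) = 0\<close>: the left side vanishes, and
  \<open>n! c \<noteq> 0\<close> in characteristic \<open>0\<close>.
\<close>

lemma commutator_nilpotent_mod:
  fixes scale :: "'k::field_char_0 \<Rightarrow> 'b::ab_group_add \<Rightarrow> 'b"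
  assumes "finite_dimensional_vector_space scale Basis"
  assumes X: "Vector_Spaces.linear scale scale X" and Y: "Vector_Spaces.linear scale scale Y"
    and I: "module.subspace scale I" and J: "module.subspace scale J"
    and inv: "\<And>v. v \<in> I \<Longrightarrow> X v \<in> I" "\<And>v. v \<in> I \<Longrightarrow> Y v \<in> I"
      "\<And>v. v \<in> J \<Longrightarrow> X v \<in> J" "\<And>v. v \<in> J \<Longrightarrow> Y v \<in> J"
    and W: "\<And>v. W v = Y (X v) - X (Y v)"
    and comm: "\<And>v. v \<in> I \<Longrightarrow> Y (W v) - W (Y v) \<in> J"
  shows "\<exists>n. \<forall>v\<in>I. (W ^^ n) v \<in> J"
proof -
  interpret finite_dimensional_vector_space scale Basis by fact
  note Xs = linear_op_simps[OF X] and Ys = linear_op_simps[OF Y]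
  have Xd: "X (u - v) = X u - X v" and Yd: "Y (u - v) = Y u - Y v" for u v
    using X Y by (auto simp: linear_iff_module_hom module_hom.diff)
  have Wd: "W (u - v) = W u - W v" and Wscale: "W (scale c u) = scale c (W u)" for u v c
    by (simp_all add: W Xs Ys Xd Yd algebra_simps scale_right_diff_distrib)
  note Isub = subspace_add[OF I] subspace_diff[OF I] subspace_scale[OF I] subspace_0[OF I]
  note Jsub = subspace_add[OF J] subspace_diff[OF J] subspace_scale[OF J] subspace_0[OF J]
  have WI: "W v \<in> I" if "v \<in> I" for v using that inv Isub by (simp add: W)
  have WJ: "W v \<in> J" if "v \<in> J" for v using that inv Jsub by (simp add: W)
  let ?D = "commutator Y"
  have D_I: "(?D ^^ n) T v \<in> I" if "\<And>v. v \<in> I \<Longrightarrow> T v \<in> I" "v \<in> I" for n T v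
    using that(2) by (induction n arbitrary: v) (auto simp: commutator_def that inv Isub)
  \<comment> \<open>\<open>D\<^sup>n\<^sup>+\<^sup>1 (X T) = X D\<^sup>n\<^sup>+\<^sup>1 T + (n + 1) W D\<^sup>n T\<close>, the higher terms being absent since \<open>D\<^sup>2 X = 0\<close>.\<close>
  have leibniz: "(?D ^^ Suc n) (\<lambda>v. X (T v)) v
      - (X ((?D ^^ Suc n) T v) + scale (of_nat (Suc n)) (W ((?D ^^ n) T v))) \<in> J"
    if T: "\<And>v. v \<in> I \<Longrightarrow> T v \<in> I" and v: "v \<in> I" for n T v
    using v
  proof (induction n arbitrary: v)
    case 0
    have "(?D ^^ Suc 0) (\<lambda>v. X (T v)) v
      - (X ((?D ^^ Suc 0) T v) + scale (of_nat (Suc 0)) (W ((?D ^^ 0) T v))) = 0"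
      by (simp add: commutator_def W Xd)
    then show ?case by (simp only: Jsub)
  next
    case (Suc n)
    define S where "S = (?D ^^ Suc n) (\<lambda>v. X (T v))"
    define P where "P = (?D ^^ n) T"
    let ?c = "of_nat (Suc n) :: 'k"
    let ?A = "\<lambda>v. X (?D P v) + scale ?c (W (P v))"
    have IH: "S u - ?A u \<in> J" if "u \<in> I" for u
      using Suc.IH[OF that] by (simp add: S_def P_def)
    have "Y (S v - ?A v) - (S (Y v) - ?A (Y v)) \<in> J"
      using Suc.prems by (intro Jsub inv IH)
    moreover have "scale ?c (Y (W (P v)) - W (Y (P v))) \<in> J"
      using D_I[where T = T and n = n, OF T Suc.prems] Suc.prems by (intro Jsub comm) (auto simp: P_def)
    ultimately have "Y (S v - ?A v) - (S (Y v) - ?A (Y v)) + scale ?c (Y (W (P v)) - W (Y (P v))) \<in> J"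
      by (rule Jsub)
    also have "Y (S v - ?A v) - (S (Y v) - ?A (Y v)) + scale ?c (Y (W (P v)) - W (Y (P v)))
      = ?D S v - (X (?D (?D P) v) + scale (1 + ?c) (W (?D P v)))"
      by (simp add: commutator_def[abs_def] W Xs Ys Xd Yd algebra_simps scale_left_distrib
          scale_right_distrib scale_right_diff_distrib del: of_nat_Suc)
    finally show ?case by (simp add: S_def P_def del: of_nat_Suc) (simp add: algebra_simps)
  qed
  have poly_I: "poly_op X p v \<in> I" if "v \<in> I" for p v
    by (induction p) (auto simp: X that inv Isub)
  have D_zero: "(?D ^^ n) (\<lambda>_. 0) = (\<lambda>_. 0)" for n
    by (induction n) (auto simp: commutator_def Ys)
  have main: "(?D ^^ n) (poly_op X p) v - scale (fact n * coeff p n) ((W ^^ n) v) \<in> J"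
    if "degree p \<le> n" "v \<in> I" for n p v
    using that
  proof (induction p arbitrary: n v)
    case 0
    have "poly_op X 0 = (\<lambda>_. 0)" by (auto simp: X)
    then show ?case by (simp add: Jsub D_zero)
  next
    case (pCons a p)
    show ?case
    proof (cases n)
      case 0
      then have "p = 0" using pCons.prems by (auto split: if_splits)
      then show ?thesis using 0 by (simp add: X Xs Jsub)
    next
      case (Suc m)
      have deg: "degree p \<le> m" using pCons.prems Suc by (auto split: if_splits)
      \<comment> \<open>The constant term commutes with \<open>Y\<close>, so one application of \<open>D\<close> removes it.\<close>
      have "?D (poly_op X (pCons a p)) = ?D (\<lambda>v. X (poly_op X p v))"
        by (auto simp: commutator_def[abs_def] X Ys)
      then have eq: "(?D ^^ n) (poly_op X (pCons a p)) = (?D ^^ Suc m) (\<lambda>v. X (poly_op X p v))"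
        unfolding Suc funpow_Suc_right by simp
      have "coeff p (Suc m) = 0" using deg by (simp add: coeff_eq_0)
      then have top: "(?D ^^ Suc m) (poly_op X p) v \<in> J"
        using pCons.IH[of "Suc m" v] deg pCons.prems by simp
      have low: "(?D ^^ m) (poly_op X p) v - scale (fact m * coeff p m) ((W ^^ m) v) \<in> J"
        using pCons.IH deg pCons.prems by blast
      let ?c = "of_nat (Suc m) :: 'k"
      have "((?D ^^ Suc m) (\<lambda>v. X (poly_op X p v)) v
          - (X ((?D ^^ Suc m) (poly_op X p) v) + scale ?c (W ((?D ^^ m) (poly_op X p) v))))
        + X ((?D ^^ Suc m) (poly_op X p) v)
        + scale ?c (W ((?D ^^ m) (poly_op X p) v - scale (fact m * coeff p m) ((W ^^ m) v))) \<in> J"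
        by (rule Jsub(1)[OF Jsub(1)[OF leibniz[where T = "poly_op X p" and n = m, OF poly_I pCons.prems(2)]
              inv(3)[OF top]] Jsub(3)[OF WJ[OF low]]])
      then show ?thesis
        unfolding eq by (simp add: Suc Wd Wscale scale_right_diff_distrib algebra_simps)
    qed
  qed
  obtain p where p: "p \<noteq> 0" "\<And>v. poly_op X p v = 0" using exists_annihilating_poly[OF X] by blast
  let ?n = "degree p"
  have pX: "poly_op X p = (\<lambda>_. 0)" using p by auto
  have "(W ^^ ?n) v \<in> J" if "v \<in> I" for v
  proof -
    define c where "c = fact ?n * coeff p ?n"
    have c: "c \<noteq> 0" using p by (simp add: c_def)
    have "0 - scale c ((W ^^ ?n) v) \<in> J"
      using main[of p ?n v] that by (simp add: pX D_zero c_def)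
    from Jsub(3)[OF this, of "- inverse c"] c show ?thesis by simp
  qed
  then show ?thesis by blast
qed

section \<open>Ideals of a transposed Poisson algebra\<close>

locale fd_transposed_poisson_algebra =
  transposed_poisson_algebra scale mul brk + finite_dimensional_vector_space scale Basis
  for scale :: "'k::field_char_0 \<Rightarrow> 'a::ab_group_add \<Rightarrow> 'a" and mul brk Basis
begin

lemma mul_simps:
  "mul (x + y) z = mul x z + mul y z" "mul x (y + z) = mul x y + mul x z"
  "mul (x - y) z = mul x z - mul y z" "mul x (y - z) = mul x y - mul x z"
  "mul (scale c x) z = scale c (mul x z)" "mul x (scale c z) = scale c (mul x z)"
  "mul 0 x = 0" "mul x 0 = 0"
proof -
  note l = mul_linear_left[unfolded linear_iff_module_hom]
    and r = mul_linear_right[unfolded linear_iff_module_hom]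
  show "mul (x + y) z = mul x z + mul y z" "mul (x - y) z = mul x z - mul y z"
    "mul (scale c x) z = scale c (mul x z)" "mul 0 x = 0"
    by (rule module_hom.add[OF l] module_hom.diff[OF l] module_hom.scale[OF l] module_hom.zero[OF l])+
  show "mul x (y + z) = mul x y + mul x z" "mul x (y - z) = mul x y - mul x z"
    "mul x (scale c z) = scale c (mul x z)" "mul x 0 = 0"
    by (rule module_hom.add[OF r] module_hom.diff[OF r] module_hom.scale[OF r] module_hom.zero[OF r])+
qed

lemma brk_simps:
  "brk (x + y) z = brk x z + brk y z" "brk x (y + z) = brk x y + brk x z"
  "brk (x - y) z = brk x z - brk y z" "brk x (y - z) = brk x y - brk x z"
  "brk (scale c x) z = scale c (brk x z)" "brk x (scale c z) = scale c (brk x z)"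
  "brk 0 x = 0" "brk x 0 = 0"
proof -
  note l = brk_linear_left[unfolded linear_iff_module_hom]
    and r = brk_linear_right[unfolded linear_iff_module_hom]
  show "brk (x + y) z = brk x z + brk y z" "brk (x - y) z = brk x z - brk y z"
    "brk (scale c x) z = scale c (brk x z)" "brk 0 x = 0"
    by (rule module_hom.add[OF l] module_hom.diff[OF l] module_hom.scale[OF l] module_hom.zero[OF l])+
  show "brk x (y + z) = brk x y + brk x z" "brk x (y - z) = brk x y - brk x z"
    "brk x (scale c z) = scale c (brk x z)" "brk x 0 = 0"
    by (rule module_hom.add[OF r] module_hom.diff[OF r] module_hom.scale[OF r] module_hom.zero[OF r])+
qed

lemma brk_anticommute: "brk y x = - brk x y"
proof -
  have "brk (x + y) (x + y) = brk x y + brk y x"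
    unfolding brk_simps by (simp add: brk_alternating)
  then show ?thesis by (simp add: brk_alternating eq_neg_iff_add_eq_0 add.commute)
qed

text \<open>The Jacobi identity in operator form: \<open>a\<^bsub>[x,y]\<^esub> = a\<^sub>x a\<^sub>y - a\<^sub>y a\<^sub>x\<close>.\<close>

lemma brk_brk_left: "brk (brk x y) v = brk x (brk y v) - brk y (brk x v)"
proof -
  have "brk y (brk v x) = - brk y (brk x v)"
    using brk_simps(4)[of y 0 "brk x v"] by (simp add: brk_anticommute[of v x] brk_simps)
  moreover have "brk v (brk x y) = - brk (brk x y) v" by (rule brk_anticommute)
  ultimately show ?thesis using brk_jacobi[of x y v] by (simp add: algebra_simps)
qed

text \<open>The transposed Leibniz rule in operator form: \<open>a\<^bsub>zx\<^esub> = 2 l\<^sub>z a\<^sub>x - a\<^sub>x l\<^sub>z\<close>.\<close>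

lemma brk_mul_left: "brk (mul z x) v = scale 2 (mul z (brk x v)) - brk x (mul z v)"
  by (simp add: transposed_leibniz)

definition gd_ideal :: "'a set \<Rightarrow> bool"
  where "gd_ideal I \<longleftrightarrow> subspace I \<and> (\<forall>x. \<forall>v\<in>I. mul x v \<in> I \<and> brk x v \<in> I)"

lemma gd_idealD:
  assumes "gd_ideal I"
  shows "subspace I" "v \<in> I \<Longrightarrow> mul x v \<in> I" "v \<in> I \<Longrightarrow> brk x v \<in> I"
    "v \<in> I \<Longrightarrow> mul v x \<in> I" "v \<in> I \<Longrightarrow> brk v x \<in> I" "0 \<in> I"
    "u \<in> I \<Longrightarrow> v \<in> I \<Longrightarrow> u + v \<in> I" "u \<in> I \<Longrightarrow> v \<in> I \<Longrightarrow> u - v \<in> I" "v \<in> I \<Longrightarrow> scale c v \<in> I"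
  using assms subspace_neg[of I] by (auto simp: gd_ideal_def mul_commute[of v x] brk_anticommute[of v x]
      subspace_0 subspace_add subspace_diff subspace_scale)

lemma mem_if_scale_2: "subspace J \<Longrightarrow> scale 2 v \<in> J \<Longrightarrow> v \<in> J"
  using subspace_scale[of J "scale 2 v" "1/2"] by simp

lemma subspace_set_plus: "subspace S \<Longrightarrow> subspace T \<Longrightarrow> subspace (S + T)"
  using subspace_sums[of S T] by (simp add: set_plus_def Bex_def conj_ac)

lemma gd_ideal_UNIV: "gd_ideal UNIV" and gd_ideal_0: "gd_ideal {0}"
  by (auto simp: gd_ideal_def mul_simps brk_simps)

lemma gd_ideal_plus:
  assumes "gd_ideal I" "gd_ideal J"
  shows "gd_ideal (I + J)"
  unfolding gd_ideal_def
proof (intro conjI allI ballI)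
  show "subspace (I + J)" using assms by (intro subspace_set_plus gd_idealD)
  fix x v assume "v \<in> I + J"
  then obtain a b where v: "v = a + b" "a \<in> I" "b \<in> J" by (auto simp: set_plus_def)
  then show "mul x v \<in> I + J" "brk x v \<in> I + J"
    using assms by (auto simp: mul_simps brk_simps intro!: set_plus_intro gd_idealD(2,3))
qed

lemma gd_ideal_spanI:
  assumes "\<And>x s. s \<in> S \<Longrightarrow> mul x s \<in> span S" "\<And>x s. s \<in> S \<Longrightarrow> brk x s \<in> span S"
  shows "gd_ideal (span S)"
  unfolding gd_ideal_def
proof (intro conjI allI ballI)
  fix x v assume v: "v \<in> span S"
  let ?T = "{v. mul x v \<in> span S \<and> brk x v \<in> span S}"
  have "subspace ?T"
    by (rule subspaceI) (simp_all add: mul_simps brk_simps span_add span_scale span_zero)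
  then have *: "span S \<subseteq> ?T" using assms by (intro span_minimal) auto
  show "mul x v \<in> span S" "brk x v \<in> span S" using v * by auto
qed simp

text \<open>
  The Jacobi identity expresses \<open>[x, [u, v]]\<close>, and the transposed Leibniz rule \<open>2 z \<cdot> [u, v]\<close>, through
  brackets of an element of \<open>E\<close> with an element of \<open>I\<close>.
\<close>

lemma gd_ideal_brk:
  assumes E: "gd_ideal E" and I: "gd_ideal I"
  shows "gd_ideal (product_span scale brk E I)"
  unfolding product_span_def
proof (rule gd_ideal_spanI)
  let ?S = "{brk u v |u v. u \<in> E \<and> v \<in> I}"
  have S: "brk u v \<in> span ?S" if "u \<in> E" "v \<in> I" for u v
    using that by (intro span_base) blast
  fix x s assume "s \<in> ?S"
  then obtain u v where s: "s = brk u v" and uv: "u \<in> E" "v \<in> I" by blast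
  have "scale 2 (mul x s) \<in> span ?S"
    unfolding s transposed_leibniz
    using uv by (intro span_add S gd_idealD(2)[OF E] gd_idealD(2)[OF I])
  then show "mul x s \<in> span ?S" by (rule mem_if_scale_2[OF subspace_span])
  have "brk x s = brk (brk x u) v + brk u (brk x v)"
    unfolding s by (simp add: brk_brk_left)
  then show "brk x s \<in> span ?S"
    using uv by (auto intro!: span_add S gd_idealD(3)[OF E] gd_idealD(3)[OF I])
qed

lemma product_span_subset:
  assumes "subspace T" "\<And>u v. u \<in> U \<Longrightarrow> v \<in> V \<Longrightarrow> f u v \<in> T"
  shows "product_span scale f U V \<subseteq> T"
  unfolding product_span_def using assms by (intro span_minimal) auto

lemma product_spanI: "u \<in> U \<Longrightarrow> v \<in> V \<Longrightarrow> f u v \<in> product_span scale f U V"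
  unfolding product_span_def by (intro span_base) blast

lemma subspace_product_span: "subspace (product_span scale f U V)"
  by (simp add: product_span_def)

lemma product_span_mono:
  assumes "U \<subseteq> U'" "V \<subseteq> V'"
  shows "product_span scale f U V \<subseteq> product_span scale f U' V'"
  using assms by (intro product_span_subset subspace_product_span product_spanI) auto

lemma gd_derived_1_mul: "mul x y \<in> gd_derived scale mul brk UNIV 1"
  and gd_derived_1_brk: "brk x y \<in> gd_derived scale mul brk UNIV 1"
proof -
  have "mul x y + 0 \<in> gd_derived scale mul brk UNIV 1" "0 + brk x y \<in> gd_derived scale mul brk UNIV 1"
    by (simp_all only: One_nat_def gd_derived.simps set_plus_intro product_spanI UNIV_I
        subspace_0[OF subspace_product_span])
  then show "mul x y \<in> gd_derived scale mul brk UNIV 1" "brk x y \<in> gd_derived scale mul brk UNIV 1"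
    by simp_all
qed

lemma gd_ideal_gd_derived_1: "gd_ideal (gd_derived scale mul brk UNIV 1)"
  unfolding gd_ideal_def
proof (intro conjI allI ballI gd_derived_1_mul gd_derived_1_brk)
  show "subspace (gd_derived scale mul brk UNIV 1)"
    by (simp add: subspace_set_plus subspace_product_span)
qed

text \<open>Iterated squaring stays in the derived series, so solvability makes every element nilpotent.\<close>

lemma gd_derived_square_power:
  "((\<lambda>s. mul s s) ^^ n) z \<in> gd_derived scale mul brk UNIV n"
proof (induction n)
  case (Suc n)
  have "mul s s + 0 \<in> product_span scale mul D D + product_span scale brk D D" if "s \<in> D" for s D
    using that by (intro set_plus_intro product_spanI subspace_0 subspace_product_span)
  from this[OF Suc] show ?case by simp
qed simp

lemma mul_nilpotent_if_gd_solvable: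
  assumes "gd_solvable scale mul brk UNIV"
  shows "\<exists>n. \<forall>z v. (mul z ^^ n) v = 0"
proof -
  obtain N where N: "gd_derived scale mul brk UNIV N = {0}"
    using assms by (auto simp: gd_solvable_def)
  have power: "(mul z ^^ (2 ^ n)) v = mul (((\<lambda>s. mul s s) ^^ n) z) v" for n z v
  proof (induction n arbitrary: v)
    case (Suc n)
    have "(mul z ^^ (2 ^ Suc n)) v = (mul z ^^ (2 ^ n)) ((mul z ^^ (2 ^ n)) v)"
      by (simp add: funpow_add mult_2)
    then show ?case by (simp add: Suc mul_assoc)
  qed simp
  have "(mul z ^^ (2 ^ N)) v = 0" for z v
    using gd_derived_square_power[of N z] by (simp add: power N mul_simps)
  then show ?thesis by blast
qed

text \<open>
  A common kernel vector of the commuting nilpotent operators \<open>l\<^sub>z\<close> on \<open>M / P\<close>. Take an invariant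
  \<open>U\<close> strictly above \<open>P\<close> of least dimension. The part of \<open>U\<close> that \<open>z\<close> sends into \<open>P\<close> is invariant and
  larger than \<open>P\<close>, because \<open>l\<^sub>z\<close> is nilpotent; so it is \<open>U\<close>, for every \<open>z\<close>.
\<close>

lemma mul_annihilated_mod:
  assumes nil: "\<And>z v. (mul z ^^ n) v = 0"
    and M: "subspace M" "\<And>z v. v \<in> M \<Longrightarrow> mul z v \<in> M"
    and P: "subspace P" "\<And>z v. v \<in> P \<Longrightarrow> mul z v \<in> P" and PM: "P \<subset> M"
  shows "\<exists>w\<in>M - P. \<forall>z. mul z w \<in> P"
proof -
  let ?Q = "\<lambda>U. subspace U \<and> (\<forall>z. \<forall>v\<in>U. mul z v \<in> U) \<and> P \<subset> U \<and> U \<subseteq> M"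
  have "?Q M" using M PM by auto
  then have "\<exists>U. ?Q U \<and> (\<forall>U'. ?Q U' \<longrightarrow> dim U \<le> dim U')" by (rule ex_has_least_nat[where m = dim])
  then obtain U where U: "?Q U" and min: "\<And>U'. ?Q U' \<Longrightarrow> dim U \<le> dim U'"
    by (elim exE conjE) iprover
  have "mul z u \<in> P" if u: "u \<in> U" for z u
  proof -
    let ?V = "{u \<in> U. mul z u \<in> P}"
    have sub: "subspace ?V"
      using U P by (intro subspaceI) (auto simp: mul_simps intro: subspace_add subspace_scale subspace_0)
    have stable: "mul x v \<in> ?V" if "v \<in> ?V" for x v
      using that U P(2)[of "mul z v" x] by (simp add: mul_assoc[symmetric] mul_commute[of z x])
    have "?V \<noteq> P"
    proof
      assume VP: "?V = P"
      obtain v where v: "v \<in> U" "v \<notin> P" using U by blast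
      have "(mul z ^^ k) v \<in> U - P" for k
        using v VP U by (induction k) auto
      then show False using nil subspace_0[OF P(1)] by (metis DiffD2)
    qed
    then have "?Q ?V" using sub stable U P by auto
    then have "?V = U" using min[of ?V] sub U by (intro subspace_dim_equal) auto
    then show ?thesis using u by blast
  qed
  then show ?thesis using U by blast
qed

section \<open>Chief factors of a solvable algebra\<close>

context
  fixes I J :: "'a set"
  assumes I: "gd_ideal I" and J: "gd_ideal J" and JI: "J \<subset> I"
    and chief: "\<And>M. gd_ideal M \<Longrightarrow> J \<subseteq> M \<Longrightarrow> M \<subseteq> I \<Longrightarrow> M = J \<or> M = I"
begin

text \<open>The kernel of the Lie action of the whole algebra on \<open>I / J\<close>.\<close>

definition centralizer :: "'a set" where "centralizer = {x. \<forall>v\<in>I. brk x v \<in> J}"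

lemma centralizerD: "x \<in> centralizer \<Longrightarrow> v \<in> I \<Longrightarrow> brk x v \<in> J"
  by (simp add: centralizer_def)

lemma gd_ideal_centralizer: "gd_ideal centralizer"
  unfolding gd_ideal_def
proof (intro conjI allI ballI)
  show "subspace centralizer"
    by (rule subspaceI) (auto simp: centralizer_def brk_simps intro: gd_idealD(6,7,9)[OF J])
next
  fix z x assume x: "x \<in> centralizer"
  show "mul z x \<in> centralizer" "brk z x \<in> centralizer"
    using centralizerD[OF x] unfolding centralizer_def
    by (auto simp: brk_mul_left brk_brk_left gd_idealD(2,3)[OF I]
        intro!: gd_idealD(2,8,9)[OF J] gd_idealD(3)[OF J, of _ z])
qed

lemma brk_plus_eq_chief:
  assumes E: "gd_ideal E" and "\<not> E \<subseteq> centralizer"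
  shows "product_span scale brk E I + J = I"
proof -
  let ?M = "product_span scale brk E I"
  have "?M \<subseteq> I" by (intro product_span_subset gd_idealD(1,3)[OF I])
  then have "?M + J \<subseteq> I" using JI by (auto simp: set_plus_def intro!: gd_idealD(7)[OF I])
  moreover have "J \<subseteq> ?M + J"
    using set_plus_intro[OF subspace_0[OF subspace_product_span]] by fastforce
  moreover have "?M + J \<noteq> J"
  proof -
    obtain e v where ev: "e \<in> E" "v \<in> I" "brk e v \<notin> J"
      using assms by (auto simp: centralizer_def)
    have "brk e v + 0 \<in> ?M + J"
      using ev by (intro set_plus_intro product_spanI gd_idealD(6)[OF J])
    then show ?thesis using ev by auto
  qed
  ultimately show ?thesis
    using chief gd_ideal_plus[OF gd_ideal_brk[OF E I] J] by blast
qed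

text \<open>
  If \<open>span S\<close> does not centralize \<open>I / J\<close>, then its brackets fill \<open>I / J\<close>. Commuting nilpotent operators
  cannot do this: let \<open>U\<close> be a maximal proper subspace between \<open>J\<close> and \<open>I\<close> that is stable under \<open>S\<close>.
  For \<open>s \<in> S\<close> the space \<open>[s, I] + U\<close> is again stable; iterating \<open>I = [s, I] + U\<close> would give
  \<open>I = a\<^sub>s\<^sup>n I + U = U\<close>, so by maximality \<open>[s, I] \<subseteq> U\<close>. All brackets thus lie in the proper subspace \<open>U\<close>.
\<close>

lemma nilpotent_generators_in_centralizer:
  assumes E: "gd_ideal (span S)"
    and comm: "\<And>s t. s \<in> S \<Longrightarrow> t \<in> S \<Longrightarrow> brk s t \<in> centralizer"
    and nil: "\<And>s. s \<in> S \<Longrightarrow> \<exists>n. \<forall>v\<in>I. (brk s ^^ n) v \<in> J"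
  shows "span S \<subseteq> centralizer"
proof (rule ccontr)
  assume not: "\<not> ?thesis"
  let ?Q = "\<lambda>U. subspace U \<and> J \<subseteq> U \<and> U \<subset> I \<and> (\<forall>s\<in>S. \<forall>u\<in>U. brk s u \<in> U)"
  have "?Q J"
    by (intro conjI ballI gd_idealD(1,3)[OF J] JI order_refl)
  then have "\<exists>U. ?Q U \<and> (\<forall>U'. ?Q U' \<longrightarrow> dim U' \<le> dim U)"
    using dim_subset_UNIV
    by (intro ex_has_greatest_nat[of ?Q J dim "Suc dimension"]) (simp_all add: less_Suc_eq_le)
  then obtain U where U: "?Q U" and max: "\<And>U'. ?Q U' \<Longrightarrow> dim U' \<le> dim U"
    by (elim exE conjE) iprover
  have SI: "brk s v \<in> U" if s: "s \<in> S" and v: "v \<in> I" for s v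
  proof -
    let ?V = "brk s ` I + U"
    have img: "subspace (brk s ` I)"
      by (rule module_hom.subspace_image[OF brk_linear_right[unfolded linear_iff_module_hom]
            gd_idealD(1)[OF I]])
    have sub: "subspace ?V" using img U by (intro subspace_set_plus) auto
    have UV: "U \<subseteq> ?V" using set_plus_intro[OF subspace_0[OF img]] by fastforce
    have VI: "?V \<subseteq> I" using U by (auto simp: set_plus_def intro!: gd_idealD(3,7)[OF I])
    have stable: "brk t w \<in> ?V" if t: "t \<in> S" and w: "w \<in> ?V" for t w
    proof -
      obtain y u where yu: "w = brk s y + u" "y \<in> I" "u \<in> U"
        using w by (auto simp: set_plus_def)
      have "brk t w = brk s (brk t y) + (brk (brk t s) y + brk t u)"
        by (simp add: yu brk_simps brk_brk_left)
      moreover have "brk (brk t s) y + brk t u \<in> U"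
        using U t centralizerD[OF comm[OF t s] yu(2)] yu by (intro subspace_add) auto
      ultimately show ?thesis using yu gd_idealD(3)[OF I] by (auto intro!: set_plus_intro)
    qed
    have "?V \<noteq> I"
    proof
      assume VI: "?V = I"
      obtain n where n: "\<forall>v\<in>I. (brk s ^^ n) v \<in> J" using nil[OF s] by blast
      have approx: "\<exists>y\<in>I. x - (brk s ^^ k) y \<in> U" if "x \<in> I" for x k
        using that
      proof (induction k arbitrary: x)
        case 0
        then show ?case using U subspace_0[of U] by (intro bexI[of _ x]) auto
      next
        case (Suc k)
        obtain y u where yu: "x = brk s y + u" "y \<in> I" "u \<in> U"
          using Suc.prems by (subst (asm) VI[symmetric]) (auto simp: set_plus_def)
        obtain y' where y': "y' \<in> I" "y - (brk s ^^ k) y' \<in> U" using Suc.IH yu by blast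
        have "brk s (y - (brk s ^^ k) y') + u \<in> U" using U s y' yu by (intro subspace_add) auto
        then show ?case using y' by (intro bexI[of _ y']) (simp_all add: yu brk_simps algebra_simps)
      qed
      have "x \<in> U" if x: "x \<in> I" for x
      proof -
        obtain y where "y \<in> I" "x - (brk s ^^ n) y \<in> U" using approx[OF x] by blast
        then have "(x - (brk s ^^ n) y) + (brk s ^^ n) y \<in> U"
          using n U by (intro subspace_add) auto
        then show ?thesis by simp
      qed
      then show False using U by blast
    qed
    then have "dim ?V \<le> dim U" using sub UV VI stable U by (intro max) auto
    then have "U = ?V" using sub UV U by (intro subspace_dim_equal) auto
    moreover have "brk s v + 0 \<in> ?V" using U v subspace_0[of U] by (intro set_plus_intro) auto
    ultimately show ?thesis by simp
  qed
  have "brk e v \<in> U" if "e \<in> span S" "v \<in> I" for e v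
  proof -
    have "span S \<subseteq> {e. brk e v \<in> U}"
      using SI that U by (intro span_minimal subsetI CollectI subspaceI)
        (auto simp: brk_simps intro: subspace_add subspace_scale subspace_0)
    then show ?thesis using that by blast
  qed
  then have "product_span scale brk (span S) I \<subseteq> U" using U by (intro product_span_subset) auto
  then have "product_span scale brk (span S) I + J \<subseteq> U"
    using U by (auto simp: set_plus_def intro!: subspace_add)
  then show False using brk_plus_eq_chief[OF E not] U by auto
qed

lemma brk_nilpotent_mod:
  assumes "brk y (brk y x) \<in> centralizer"
  shows "\<exists>n. \<forall>v\<in>I. (brk (brk y x) ^^ n) v \<in> J"
proof (rule commutator_nilpotent_mod[where X = "brk x" and Y = "brk y"])
  show "finite_dimensional_vector_space scale Basis" ..
  show "brk y (brk (brk y x) v) - brk (brk y x) (brk y v) \<in> J" if "v \<in> I" for v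
    using centralizerD[OF assms that] by (simp add: brk_brk_left)
qed (simp_all add: brk_brk_left gd_idealD(1,3)[OF I] gd_idealD(1,3)[OF J] brk_linear_right)

text \<open>
  The nilpotency criterion is used twice. For \<open>d \<in> D\<close> the element \<open>[d, x]\<close> commutes with \<open>d\<close> on
  \<open>I / J\<close>, as both are in \<open>D\<close>; so \<open>[D, A]\<close> is generated by nilpotents and acts as \<open>0\<close>. Therefore \<open>D\<close> acts
  centrally, and each generator \<open>[x, y]\<close> of \<open>D = [C, C]\<close> commutes with \<open>x\<close>, hence acts nilpotently too.
\<close>

lemma derived_in_centralizer_step:
  assumes C: "gd_ideal C" and D_def: "D = product_span scale brk C C"
    and DD: "product_span scale brk D D \<subseteq> centralizer"
  shows "D \<subseteq> centralizer"
proof -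
  have D: "gd_ideal D" unfolding D_def by (rule gd_ideal_brk[OF C C])
  have DDk: "brk x y \<in> centralizer" if "x \<in> D" "y \<in> D" for x y
    using DD product_spanI[OF that, of brk] by blast
  have "span {brk d x |d x. d \<in> D \<and> x \<in> UNIV} \<subseteq> centralizer"
  proof (rule nilpotent_generators_in_centralizer)
    show "gd_ideal (span {brk d x |d x. d \<in> D \<and> x \<in> UNIV})"
      using gd_ideal_brk[OF D gd_ideal_UNIV] by (simp add: product_span_def)
  qed (auto intro!: DDk brk_nilpotent_mod gd_idealD(5)[OF D])
  then have AD: "brk d x \<in> centralizer" if "d \<in> D" for d x
    using that span_base[of "brk d x" "{brk d x |d x. d \<in> D \<and> x \<in> UNIV}"] by blast
  have CC: "brk x y \<in> D" if "x \<in> C" "y \<in> C" for x y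
    unfolding D_def using that by (rule product_spanI)
  have "span {brk x y |x y. x \<in> C \<and> y \<in> C} \<subseteq> centralizer"
  proof (rule nilpotent_generators_in_centralizer)
    show "gd_ideal (span {brk x y |x y. x \<in> C \<and> y \<in> C})"
      using D by (simp add: D_def product_span_def)
    show "\<exists>n. \<forall>v\<in>I. (brk s ^^ n) v \<in> J" if s: "s \<in> {brk x y |x y. x \<in> C \<and> y \<in> C}" for s
    proof -
      obtain x y where xy: "s = brk x y" "x \<in> C" "y \<in> C" using s by blast
      have "brk x (brk x y) \<in> centralizer"
        using AD[OF CC[OF xy(2,3)], of x] gd_idealD(8)[OF gd_ideal_centralizer gd_idealD(6)[OF gd_ideal_centralizer]]
        by (metis brk_anticommute diff_0)
      then show ?thesis unfolding xy by (rule brk_nilpotent_mod)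
    qed
  qed (auto intro!: AD CC)
  then show ?thesis by (simp add: D_def product_span_def)
qed

text \<open>
  The derived series of the Lie algebra lies in the derived series of both operations, so it ends in
  \<open>0\<close>, which centralizes; the preceding lemma then climbs from the last term to \<open>[A, A]\<close>.
\<close>

lemma brk_in_centralizer_if_gd_solvable:
  assumes "gd_solvable scale mul brk UNIV"
  shows "brk x y \<in> centralizer"
proof -
  obtain N where N: "gd_derived scale mul brk UNIV N = {0}"
    using assms by (auto simp: gd_solvable_def)
  let ?L = "\<lambda>n. ((\<lambda>D. product_span scale brk D D) ^^ n) UNIV"
  have ideal: "gd_ideal (?L n)" for n
    by (induction n) (simp_all add: gd_ideal_UNIV gd_ideal_brk)
  have derived: "?L n \<subseteq> gd_derived scale mul brk UNIV n" for n
  proof (induction n)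
    case (Suc n)
    have "product_span scale brk D D \<subseteq> product_span scale mul D D + product_span scale brk D D" for D
      using set_plus_intro[OF subspace_0[OF subspace_product_span]] by fastforce
    then show ?case using product_span_mono[OF Suc Suc, of brk] by (simp, meson subset_trans)
  qed simp
  have "?L (Suc 0) \<subseteq> centralizer"
  proof (rule inc_induct[of 0 N "\<lambda>n. ?L (Suc n) \<subseteq> centralizer"])
    have "brk u v \<in> centralizer" if "u \<in> ?L N" "v \<in> ?L N" for u v
    proof -
      have "v = 0" using that derived[of N] N by blast
      then show ?thesis by (simp add: brk_simps gd_idealD(6)[OF gd_ideal_centralizer])
    qed
    then show "?L (Suc N) \<subseteq> centralizer"
      using gd_idealD(1)[OF gd_ideal_centralizer] by (simp add: product_span_subset)
  next
    fix n assume "?L (Suc (Suc n)) \<subseteq> centralizer"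
    then have "product_span scale brk (?L (Suc n)) (?L (Suc n)) \<subseteq> centralizer" by simp
    then show "?L (Suc n) \<subseteq> centralizer"
      using derived_in_centralizer_step[OF ideal[of n], of "?L (Suc n)"] by simp
  qed simp
  then show ?thesis using product_spanI[of x UNIV y UNIV brk] by auto
qed

text \<open>
  Conjugation by \<open>a\<^sub>w\<close>, for a suitable \<open>w\<close>, doubles every \<open>l\<^sub>z\<close> and fixes every \<open>a\<^sub>x\<close>. It therefore
  both doubles and fixes \<open>a\<^bsub>zx\<^esub> = 2 l\<^sub>z a\<^sub>x - a\<^sub>x l\<^sub>z\<close>, which must vanish on \<open>I / J\<close>.
\<close>

lemma mul_in_centralizer_if_gd_solvable:
  assumes solv: "gd_solvable scale mul brk UNIV"
  shows "mul z x \<in> centralizer"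
proof (cases "centralizer = UNIV")
  case False
  obtain n where n: "\<And>z v. (mul z ^^ n) v = 0"
    using mul_nilpotent_if_gd_solvable[OF solv] by blast
  have "\<exists>w\<in>UNIV - centralizer. \<forall>z. mul z w \<in> centralizer"
    using False by (intro mul_annihilated_mod[OF n] gd_idealD(1,2)[OF gd_ideal_centralizer] subspace_UNIV) auto
  then obtain w where w: "w \<notin> centralizer" and Aw: "\<And>z. mul z w \<in> centralizer" by blast
  note Jc = gd_idealD(7,8,9)[OF J]
  have wmul: "brk w (mul z v) - scale 2 (mul z (brk w v)) \<in> J" if "v \<in> I" for z v
  proof -
    have "- brk (mul z w) v \<in> J"
      using Jc(2)[OF gd_idealD(6)[OF J] centralizerD[OF Aw that, of z]] by simp
    then show ?thesis by (simp add: brk_mul_left)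
  qed
  have wbrk: "brk w (brk x v) - brk x (brk w v) \<in> J" if "v \<in> I" for x v
    using centralizerD[OF brk_in_centralizer_if_gd_solvable[OF solv] that, of w x] by (simp add: brk_brk_left)
  let ?M = "brk w ` I + J"
  have img: "subspace (brk w ` I)"
    by (rule module_hom.subspace_image[OF brk_linear_right[unfolded linear_iff_module_hom]
          gd_idealD(1)[OF I]])
  \<comment> \<open>The image of \<open>a\<^sub>w\<close> is stable because \<open>l\<^sub>z a\<^sub>w v \<equiv> a\<^sub>w (l\<^sub>z v / 2)\<close> and \<open>a\<^sub>x a\<^sub>w v \<equiv> a\<^sub>w a\<^sub>x v\<close> modulo \<open>J\<close>.\<close>
  have "gd_ideal ?M"
    unfolding gd_ideal_def
  proof (intro conjI allI ballI)
    show "subspace ?M" by (rule subspace_set_plus[OF img gd_idealD(1)[OF J]])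
    fix x m assume "m \<in> ?M"
    then obtain v j where m: "m = brk w v + j" "v \<in> I" "j \<in> J" by (auto simp: set_plus_def)
    have "mul x m = brk w (scale (1/2) (mul x v))
        + (mul x j - scale (1/2) (brk w (mul x v) - scale 2 (mul x (brk w v))))"
      by (simp add: m mul_simps brk_simps scale_right_diff_distrib)
    moreover have "mul x j - scale (1/2) (brk w (mul x v) - scale 2 (mul x (brk w v))) \<in> J"
      by (intro Jc wmul m gd_idealD(2)[OF J])
    moreover have "scale (1/2) (mul x v) \<in> I" using m by (intro gd_idealD(2,9)[OF I])
    ultimately show "mul x m \<in> ?M" by (simp only: set_plus_intro imageI)
    have "brk x m = brk w (brk x v) + (brk x j - (brk w (brk x v) - brk x (brk w v)))"
      by (simp add: m brk_simps)
    moreover have "brk x j - (brk w (brk x v) - brk x (brk w v)) \<in> J"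
      by (intro Jc wbrk m gd_idealD(3)[OF J])
    moreover have "brk x v \<in> I" using m by (intro gd_idealD(3)[OF I])
    ultimately show "brk x m \<in> ?M" by (simp only: set_plus_intro imageI)
  qed
  moreover have "J \<subseteq> ?M" using set_plus_intro[OF subspace_0[OF img]] by fastforce
  moreover have "?M \<subseteq> I" using JI by (auto simp: set_plus_def intro!: gd_idealD(3,7)[OF I])
  moreover have "?M \<noteq> J"
  proof -
    obtain v where v: "v \<in> I" "brk w v \<notin> J" using w by (auto simp: centralizer_def)
    then have "brk w v + 0 \<in> ?M" by (intro set_plus_intro imageI gd_idealD(6)[OF J])
    then show ?thesis using v by auto
  qed
  ultimately have M: "?M = I" using chief by blast
  have key: "brk (mul z x) (brk w v) \<in> J" if v: "v \<in> I" for v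
  proof -
    have commute: "brk w (brk (mul z x) v) - brk (mul z x) (brk w v) \<in> J" by (rule wbrk[OF v])
    \<comment> \<open>Expand \<open>a\<^bsub>zx\<^esub>\<close> and move \<open>a\<^sub>w\<close> to the right; each summand is the error of one such move.\<close>
    have "brk w (brk (mul z x) v) - scale 2 (brk (mul z x) (brk w v))
        = scale 2 (brk w (mul z (brk x v)) - scale 2 (mul z (brk w (brk x v))))
        + scale 4 (mul z (brk w (brk x v) - brk x (brk w v)))
        - (brk w (brk x (mul z v)) - brk x (brk w (mul z v)))
        - brk x (brk w (mul z v) - scale 2 (mul z (brk w v)))"
      by (simp add: brk_mul_left brk_simps mul_simps scale_right_diff_distrib algebra_simps)
    also have "\<dots> \<in> J"
      using v by (intro Jc wmul wbrk gd_idealD(2,3)[OF I] gd_idealD(2)[OF J, of _ z] gd_idealD(3)[OF J, of _ x])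
    finally have double: "brk w (brk (mul z x) v) - scale 2 (brk (mul z x) (brk w v)) \<in> J" .
    have "brk (mul z x) (brk w v)
        = (brk w (brk (mul z x) v) - brk (mul z x) (brk w v))
          - (brk w (brk (mul z x) v) - scale 2 (brk (mul z x) (brk w v)))"
      by (simp add: scale_left_distrib[of 1 1, simplified])
    then show ?thesis using Jc(2)[OF commute double] by simp
  qed
  show ?thesis
    unfolding centralizer_def
  proof (intro CollectI ballI)
    fix u assume "u \<in> I"
    then obtain v j where u: "u = brk w v + j" "v \<in> I" "j \<in> J"
      by (subst (asm) M[symmetric]) (auto simp: set_plus_def)
    then show "brk (mul z x) u \<in> J"
      using key[of v] gd_idealD(3)[OF J, of j] by (simp add: brk_simps Jc(1))
  qed
qed simp

text \<open>
  On the common kernel of the \<open>l\<^sub>z\<close> one has \<open>2 l\<^sub>z a\<^sub>x = a\<^bsub>zx\<^esub>\<close>, and \<open>a\<^bsub>zx\<^esub>\<close> is \<open>0\<close> modulo \<open>J\<close>; so this kernel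
  is an ideal.
\<close>

lemma mul_chief_if_gd_solvable:
  assumes solv: "gd_solvable scale mul brk UNIV" and v: "v \<in> I"
  shows "mul z v \<in> J"
proof -
  obtain n where n: "\<And>z v. (mul z ^^ n) v = 0"
    using mul_nilpotent_if_gd_solvable[OF solv] by blast
  let ?M = "{v \<in> I. \<forall>z. mul z v \<in> J}"
  have "gd_ideal ?M"
    unfolding gd_ideal_def
  proof (intro conjI allI ballI)
    show "subspace ?M"
      by (rule subspaceI) (auto simp: mul_simps intro: gd_idealD(6,7,9)[OF I] gd_idealD(6,7,9)[OF J])
    fix x v assume v: "v \<in> ?M"
    then show "mul x v \<in> ?M" using gd_idealD(2)[OF J] gd_idealD(2)[OF I] by blast
    have "mul z (brk x v) \<in> J" for z
    proof (rule mem_if_scale_2[OF gd_idealD(1)[OF J]])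
      have "brk (mul z x) v \<in> J"
        using v centralizerD[OF mul_in_centralizer_if_gd_solvable[OF solv]] by blast
      moreover have "brk x (mul z v) \<in> J" using v gd_idealD(3)[OF J] by blast
      ultimately show "scale 2 (mul z (brk x v)) \<in> J"
        unfolding transposed_leibniz by (rule gd_idealD(7)[OF J])
    qed
    then show "brk x v \<in> ?M" using v gd_idealD(3)[OF I] by blast
  qed
  moreover have "J \<subseteq> ?M" using JI gd_idealD(2)[OF J] by blast
  moreover have "?M \<noteq> J"
    using mul_annihilated_mod[OF n gd_idealD(1,2)[OF I] gd_idealD(1,2)[OF J] JI] by blast
  ultimately have "?M = I" using chief[of ?M] by blast
  then show ?thesis using v by blast
qed

lemma gd_derived_1_annihilates_chief:
  assumes solv: "gd_solvable scale mul brk UNIV"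
    and b: "b \<in> gd_derived scale mul brk UNIV 1" and v: "v \<in> I"
  shows "mul b v \<in> J" "mul v b \<in> J" "brk b v \<in> J" "brk v b \<in> J"
proof -
  have "product_span scale mul UNIV UNIV \<subseteq> centralizer"
    by (rule product_span_subset[OF gd_idealD(1)[OF gd_ideal_centralizer] mul_in_centralizer_if_gd_solvable[OF solv]])
  moreover have "product_span scale brk UNIV UNIV \<subseteq> centralizer"
    by (rule product_span_subset[OF gd_idealD(1)[OF gd_ideal_centralizer] brk_in_centralizer_if_gd_solvable[OF solv]])
  ultimately have "b \<in> centralizer"
    using b gd_idealD(7)[OF gd_ideal_centralizer] by (auto simp: set_plus_def)
  then show "brk b v \<in> J" using v by (rule centralizerD)
  then show "brk v b \<in> J"
    using gd_idealD(8)[OF J gd_idealD(6)[OF J]] brk_anticommute[of v b] by simp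
  show "mul b v \<in> J" by (rule mul_chief_if_gd_solvable[OF solv v])
  then show "mul v b \<in> J" by (simp add: mul_commute)
qed

end

section \<open>Descent along a chief series\<close>

lemma exists_chief_factor:
  assumes I: "gd_ideal I" and "I \<noteq> {0}"
  shows "\<exists>J. gd_ideal J \<and> J \<subset> I \<and> (\<forall>M. gd_ideal M \<longrightarrow> J \<subseteq> M \<longrightarrow> M \<subseteq> I \<longrightarrow> M = J \<or> M = I)"
proof -
  let ?Q = "\<lambda>U. gd_ideal U \<and> U \<subset> I"
  have "?Q {0}" using assms gd_ideal_0 gd_idealD(6)[OF I] by blast
  then have "\<exists>U. ?Q U \<and> (\<forall>U'. ?Q U' \<longrightarrow> dim U' \<le> dim U)"
    using dim_subset_UNIV
    by (intro ex_has_greatest_nat[of ?Q "{0}" dim "Suc dimension"]) (simp_all add: less_Suc_eq_le)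
  then obtain U where U: "?Q U" and max: "\<And>U'. ?Q U' \<Longrightarrow> dim U' \<le> dim U"
    by (elim exE conjE) iprover
  have "M = U" if M: "gd_ideal M" "U \<subseteq> M" "M \<subseteq> I" "M \<noteq> I" for M
    using subspace_dim_equal[OF gd_idealD(1) gd_idealD(1) M(2) max, of] U M by blast
  with U show ?thesis by blast
qed

lemma set_sum_subset:
  assumes "subspace J" "finite S" "\<And>i. i \<in> S \<Longrightarrow> f i \<subseteq> J"
  shows "sum f S \<subseteq> J"
  using assms(2,3)
proof (induction S rule: finite_induct)
  case empty
  then show ?case using subspace_0[OF assms(1)] by simp
next
  case (insert i S)
  then have "f i \<subseteq> J" "sum f S \<subseteq> J" by auto
  with insert.hyps show ?case by (auto simp: set_plus_def intro!: subspace_add[OF assms(1)])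
qed

lemma zero_in_set_sum:
  fixes f :: "'i \<Rightarrow> 'a set"
  shows "(\<And>i. i \<in> S \<Longrightarrow> 0 \<in> f i) \<Longrightarrow> 0 \<in> sum f S"
proof (induction S rule: infinite_finite_induct)
  case (insert i S)
  then have "0 + 0 \<in> f i + sum f S" by (intro set_plus_intro) auto
  with insert.hyps show ?case by simp
qed auto

lemma subset_set_sum:
  fixes f :: "'i \<Rightarrow> 'a set"
  assumes "finite S" "i \<in> S" "\<And>j. j \<in> S \<Longrightarrow> 0 \<in> f j"
  shows "f i \<subseteq> sum f S"
proof
  fix x assume "x \<in> f i"
  moreover have "0 \<in> sum f (S - {i})" using assms by (intro zero_in_set_sum) auto
  ultimately have "x + 0 \<in> f i + sum f (S - {i})" by (rule set_plus_intro)
  then show "x \<in> sum f S" using assms by (simp add: sum.remove)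
qed

lemma zero_in_product_spans: "0 \<in> product_span scale mul U V + product_span scale brk U' V'"
  using set_plus_intro[OF subspace_0[OF subspace_product_span] subspace_0[OF subspace_product_span]]
  by fastforce

lemma zero_in_gd_lower: "0 \<in> B \<Longrightarrow> 0 \<in> gd_lower scale mul brk B n"
  by (cases "(scale, mul, brk, B, n)" rule: gd_lower.cases)
    (auto simp del: sum.cl_ivl_Suc intro!: zero_in_set_sum zero_in_product_spans)

lemma zero_in_gd_derived: "0 \<in> B \<Longrightarrow> 0 \<in> gd_derived scale mul brk B n"
  by (cases n) (simp_all add: zero_in_product_spans)

lemma gd_lower_subsetI:
  assumes J: "subspace J" and n: "2 \<le> n"
    and prod: "\<And>i u v. 1 \<le> i \<Longrightarrow> i < n \<Longrightarrow> u \<in> gd_lower scale mul brk B i \<Longrightarrow>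
      v \<in> gd_lower scale mul brk B (n - i) \<Longrightarrow> mul u v \<in> J \<and> brk u v \<in> J"
  shows "gd_lower scale mul brk B n \<subseteq> J"
proof -
  obtain k where k: "n = Suc (Suc k)" using n by (metis add_2_eq_Suc le_Suc_ex)
  have plus: "X + Y \<subseteq> J" if "X \<subseteq> J" "Y \<subseteq> J" for X Y
    using that by (auto simp: set_plus_def intro!: subspace_add[OF J])
  show ?thesis
    unfolding k gd_lower.simps using prod[unfolded k]
    by (intro set_sum_subset J plus product_span_subset) auto
qed

lemma gd_lower_subset:
  assumes B: "gd_ideal B"
  shows "gd_lower scale mul brk B n \<subseteq> B"
proof (induction n rule: less_induct)
  case (less n)
  show ?case
  proof (cases "2 \<le> n")
    case True
    show ?thesis
    proof (rule gd_lower_subsetI[OF gd_idealD(1)[OF B] True])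
      fix i u v
      assume "1 \<le> i" "i < n" "v \<in> gd_lower scale mul brk B (n - i)"
      then have "v \<in> B" using less[of "n - i"] by auto
      then show "mul u v \<in> B \<and> brk u v \<in> B" by (simp add: gd_idealD(2,3)[OF B])
    qed
  next
    case False
    then consider "n = 0" | "n = Suc 0" by linarith
    then show ?thesis by cases auto
  qed
qed

text \<open>
  For \<open>n \<ge> 2 * m\<close> one of \<open>i\<close> and \<open>n - i\<close> is at least \<open>m\<close>; the corresponding factor of a product in
  degree \<open>n\<close> is in \<open>I\<close> and the other one is in \<open>A \<cdot> A + [A, A]\<close>, so the product is in \<open>J\<close>.
\<close>

lemma gd_lower_eventually_0:
  assumes solv: "gd_solvable scale mul brk UNIV"
    and I: "gd_ideal I"
    and lower: "\<And>n. n \<ge> m \<Longrightarrow> gd_lower scale mul brk (gd_derived scale mul brk UNIV 1) n \<subseteq> I"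
  shows "\<exists>m. \<forall>n\<ge>m. gd_lower scale mul brk (gd_derived scale mul brk UNIV 1) n \<subseteq> {0}"
  using I lower
proof (induction "dim I" arbitrary: I m rule: less_induct)
  case less
  let ?B = "gd_derived scale mul brk UNIV 1"
  show ?case
  proof (cases "I = {0}")
    case False
    obtain J where J: "gd_ideal J" "J \<subset> I"
      and chief: "\<And>M. gd_ideal M \<Longrightarrow> J \<subseteq> M \<Longrightarrow> M \<subseteq> I \<Longrightarrow> M = J \<or> M = I"
      using exists_chief_factor[OF less.prems(1) False] by blast
    note annih = gd_derived_1_annihilates_chief[OF less.prems(1) J chief solv]
    have "gd_lower scale mul brk ?B n \<subseteq> J" if n: "n \<ge> 2 * m + 2" for n
    proof (rule gd_lower_subsetI[OF gd_idealD(1)[OF J(1)]])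
      fix i u v
      assume uv: "u \<in> gd_lower scale mul brk ?B i" "v \<in> gd_lower scale mul brk ?B (n - i)"
      have B: "u \<in> ?B" "v \<in> ?B"
        using uv gd_lower_subset[OF gd_ideal_gd_derived_1] by blast+
      consider "i \<ge> m" | "n - i \<ge> m" using n by linarith
      then have "u \<in> I \<or> v \<in> I" using less.prems(2) uv by cases blast+
      then show "mul u v \<in> J \<and> brk u v \<in> J" using annih B by blast
    qed (use n in simp)
    moreover have "dim J < dim I"
      using J subspace_dim_equal[OF gd_idealD(1)[OF J(1)] gd_idealD(1)[OF less.prems(1)]]
      by (metis linorder_not_le psubset_eq)
    ultimately show ?thesis using less.hyps[of J] J by blast
  qed (use less.prems in blast)
qed

lemma gd_nilpotent_if_gd_solvable:
  assumes "gd_solvable scale mul brk UNIV"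
  shows "gd_nilpotent scale mul brk (gd_derived scale mul brk UNIV 1)"
proof -
  let ?B = "gd_derived scale mul brk UNIV 1"
  obtain m where m: "\<And>n. n \<ge> m \<Longrightarrow> gd_lower scale mul brk ?B n \<subseteq> {0}"
    using gd_lower_eventually_0[OF assms gd_ideal_UNIV subset_UNIV] by blast
  have "gd_lower scale mul brk ?B (Suc m) = {0}"
    using m[of "Suc m"] zero_in_gd_lower[OF gd_idealD(6)[OF gd_ideal_gd_derived_1], of "Suc m"] by auto
  then show ?thesis unfolding gd_nilpotent_def by (intro exI[of _ "Suc m"]) simp
qed

lemma gd_derived_shift:
  "gd_derived scale mul brk A (Suc n) = gd_derived scale mul brk (gd_derived scale mul brk A 1) n"
  by (induction n) simp_all

text \<open>
  A product of two terms of the derived series is a product of a member of the lower series with an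
  element of \<open>B\<close>, that is, the summand \<open>i = n + 1\<close> in degree \<open>n + 2\<close>.
\<close>

lemma gd_derived_subset_gd_lower:
  assumes B: "gd_ideal B"
  shows "gd_derived scale mul brk B n \<subseteq> B \<inter> gd_lower scale mul brk B (Suc n)"
proof (induction n)
  case (Suc n)
  let ?D = "gd_derived scale mul brk B n"
  let ?f = "\<lambda>i. product_span scale mul (gd_lower scale mul brk B i) (gd_lower scale mul brk B (Suc (Suc n) - i))
      + product_span scale brk (gd_lower scale mul brk B i) (gd_lower scale mul brk B (Suc (Suc n) - i))"
  have D: "?D \<subseteq> B" "?D \<subseteq> gd_lower scale mul brk B (Suc n)" using Suc by auto
  have "product_span scale mul ?D ?D + product_span scale brk ?D ?D \<subseteq> ?f (Suc n)"
    using D by (intro set_plus_mono2 product_span_mono) auto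
  also have "\<dots> \<subseteq> sum ?f {1..Suc n}"
    by (rule subset_set_sum) (auto simp: zero_in_product_spans)
  also have "\<dots> = gd_lower scale mul brk B (Suc (Suc n))" by simp
  finally have low: "gd_derived scale mul brk B (Suc n) \<subseteq> gd_lower scale mul brk B (Suc (Suc n))"
    by simp
  then show ?case using gd_lower_subset[OF B] by blast
qed simp

lemma gd_solvable_if_gd_nilpotent:
  assumes "gd_nilpotent scale mul brk (gd_derived scale mul brk UNIV 1)"
  shows "gd_solvable scale mul brk UNIV"
proof -
  let ?B = "gd_derived scale mul brk UNIV 1"
  obtain n where n: "gd_lower scale mul brk ?B (Suc n) = {0}"
    using assms unfolding gd_nilpotent_def by (metis One_nat_def Suc_le_D)
  have "gd_derived scale mul brk UNIV (Suc n) \<subseteq> {0}"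
    unfolding gd_derived_shift using gd_derived_subset_gd_lower[OF gd_ideal_gd_derived_1, of n] n by simp
  then have "gd_derived scale mul brk UNIV (Suc n) = {0}"
    using zero_in_gd_derived[OF UNIV_I, of "Suc n"] by blast
  then show ?thesis unfolding gd_solvable_def by blast
qed

end

theorem corollary4p13:
  fixes scale :: "'k::{alg_closed_field, field_char_0} \<Rightarrow> 'a::ab_group_add \<Rightarrow> 'a"
    and mul brk :: "'a \<Rightarrow> 'a \<Rightarrow> 'a"
  assumes "transposed_poisson_algebra scale mul brk"
    and "\<exists>Basis. finite_dimensional_vector_space scale Basis"
  shows "gd_solvable scale mul brk UNIV \<longleftrightarrow>
    gd_nilpotent scale mul brk (gd_derived scale mul brk UNIV 1)"
proof -
  interpret transposed_poisson_algebra scale mul brk by (rule assms(1))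
  obtain Basis where "finite_dimensional_vector_space scale Basis" using assms(2) by blast
  then interpret fd_transposed_poisson_algebra scale mul brk Basis
    by (intro fd_transposed_poisson_algebra.intro assms(1))
  show ?thesis using gd_nilpotent_if_gd_solvable gd_solvable_if_gd_nilpotent by blast
qed

end
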